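(* For all fixed integers $q\ge 2$, $p\ge 0$ and $m\ge 1$, as $n\to\infty$, $$\sum_{k=1}^{n} \frac{(\log k)^p}{k^q} = (-1)^p \zeta^{(p)}(q) -\frac{1}{n^{q-1}}\sum_{r=0}^p \frac{p!}{(p-r)!\,(q-1)^{r+1}} (\log n)^{p-r} +\frac12 \frac{(\log n)^p}{n^q} - \sum_{k=1}^m \frac{\sum_{r=0}^p d_{p,q,k,r} (\log n)^{p-r}}{n^{q+2k-1}} +O\Big(\frac{(\log n)^{p}}{n^{q+2m}}\Big),$$ where $$d_{p,q,k,r} = \frac{B_{2k}}{(2k)!}\,\frac{(2k+q-2)!}{(q-1)!}\,\frac{(-1)^r p!}{(p-r)!}\, S_{r,q,2k+q-2},$$ and where, in formal notation, $$(-1)^p \zeta^{(p)}(q) = \frac{p!}{(q-1)^{p+1}} +(-1)^p\, p! \sum_{k\ge1} \frac{B_{2k}}{(2k)!}\, \frac{(2k+q-2)!}{(q-1)!}\, S_{p,q,2k+q-2}$$ (for $p=0$, $\frac12$ has to be added to the right-hand side of this formal expression).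
   Context: $B_{2k}$ are the Bernoulli numbers; $\zeta^{(p)}$ is the $p$-th derivative of the Riemann zeta function; $(\log 1)^0=1$. $S_{r,s,t}:=\sum_{s\le i_1<\dots<i_r\le t}\frac{1}{i_1\cdots i_r}$ (sum over integers), which is $0$ for $r\ge 1$ and $t<r+s-1$; $S_{0,s,t}:=1$ if $t\ge s-1$, and $S_{r,s,t}:=0$ if $r<0$. The infinite sum over Bernoulli numbers diverges; "in formal notation" means that the sum is the formal expression for the constant term that arises when the Euler–Maclaurin formula is applied to the sum on the left-hand side from lower limit $1$ with all orders kept, and it stands for the exact value of that constant term. *)

theory Defs
  imports "HOL-Complex_Analysis.Complex_Analysis" "HOL-Library.Landau_Symbols"
begin

text \<open>Bernoulli numbers, in the convention \<open>x / (exp x - 1) = (\<Sum>n. B\<^sub>n x\<^sup>n / n!)\<close>,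
  i.e. \<open>B\<^sub>1 = - 1 / 2\<close>.\<close>

fun bernoulli :: "nat \<Rightarrow> real" where
  "bernoulli 0 = 1"
| "bernoulli (Suc n) =
     - (\<Sum>k\<le>n. real ((n + 2) choose k) * bernoulli k) / real (n + 2)"

definition bernpoly :: "nat \<Rightarrow> real \<Rightarrow> real" where
  "bernpoly n x = (\<Sum>k\<le>n. real (n choose k) * bernoulli k * x ^ (n - k))"

text \<open>The Riemann zeta function on its half-plane of convergence \<open>Re s > 1\<close>. No continuation
  is provided: the value is meaningless where the series diverges. Only derivatives at points
  \<open>q \<ge> 2\<close> are used.\<close>

definition zeta :: "complex \<Rightarrow> complex" where
  "zeta s = (\<Sum>n. 1 / of_nat (Suc n) powr s)"

text \<open>The sum over \<open>s \<le> i\<^sub>1 < \<dots> < i\<^sub>r \<le> t\<close> is a sum over the \<open>r\<close>-element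
  subsets \<open>{i\<^sub>1, \<dots>, i\<^sub>r}\<close> of \<open>{s..t}\<close>. For \<open>r = 0\<close> the empty set
  contributes 1.\<close>

definition S :: "nat \<Rightarrow> nat \<Rightarrow> nat \<Rightarrow> real" where
  "S r s t = (\<Sum>I | I \<subseteq> {s..t} \<and> card I = r. \<Prod>i\<in>I. 1 / real i)"

definition d :: "nat \<Rightarrow> nat \<Rightarrow> nat \<Rightarrow> nat \<Rightarrow> real" where
  "d p q k r = bernoulli (2 * k) / fact (2 * k) * (fact (2 * k + q - 2) / fact (q - 1))
     * ((-1) ^ r * fact p / fact (p - r)) * S r q (2 * k + q - 2)"

text \<open>The Euler--Maclaurin formula for \<open>f\<close> on \<open>[1, n]\<close> with \<open>M\<close> Bernoulli terms reads
  \<open>(\<Sum>k=1..n. f k) = \<integral>\<^sub>1\<^sup>n f + (f 1 + f n) / 2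
     + (\<Sum>k=1..M. B\<^sub>2\<^sub>k / (2k)! * (f\<^sup>(\<^sup>2\<^sup>k\<^sup>-\<^sup>1\<^sup>) n - f\<^sup>(\<^sup>2\<^sup>k\<^sup>-\<^sup>1\<^sup>) 1)) + \<integral>\<^sub>1\<^sup>n EM_remainder f M\<close>.\<close>

definition EM_remainder :: "(real \<Rightarrow> real) \<Rightarrow> nat \<Rightarrow> real \<Rightarrow> real" where
  "EM_remainder f M x =
     bernpoly (2 * M + 1) (frac x) / fact (2 * M + 1) * (deriv ^^ (2 * M + 1)) f x"

text \<open>\<open>EM_formal_constant f c a\<close> says that \<open>c = a 0 + a 1 + a 2 + \<dots>\<close> holds formally, as the
  constant term of the Euler--Maclaurin formula for \<open>\<Sum>k=1..n. f k\<close> with lower limit 1 and all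
  orders kept. The series itself usually diverges. So the terms \<open>a k\<close> are those contributed
  by the lower limit (with \<open>\<integral>\<^sub>1\<^sup>n = \<integral>\<^sub>1\<^sup>\<infinity> - \<integral>\<^sub>n\<^sup>\<infinity>\<close>), and \<open>c\<close> is the exact value of the constant:
  for every order \<open>M\<close>, it is the partial sum up to \<open>a M\<close> plus the constant part of the
  remainder, and it is the \<open>n\<close>-independent term of the exact formula of order \<open>M\<close>.\<close>

definition EM_formal_constant :: "(real \<Rightarrow> real) \<Rightarrow> real \<Rightarrow> (nat \<Rightarrow> real) \<Rightarrow> bool" where
  "EM_formal_constant f c a \<longleftrightarrow>
     (\<forall>j. \<forall>x\<ge>1. (deriv ^^ j) f differentiable at x) \<and>
     f integrable_on {1..} \<and>
     a 0 = integral {1..} f + f 1 / 2 \<and>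
     (\<forall>k\<ge>1. a k = - (bernoulli (2 * k) / fact (2 * k) * (deriv ^^ (2 * k - 1)) f 1)) \<and>
     (\<forall>M. EM_remainder f M integrable_on {1..} \<and>
        c = (\<Sum>k\<le>M. a k) + integral {1..} (EM_remainder f M) \<and>
        (\<forall>n::nat. n \<ge> 1 \<longrightarrow>
          (\<Sum>k=1..n. f (real k)) =
            c - integral {real n..} f + f (real n) / 2
            + (\<Sum>k=1..M. bernoulli (2 * k) / fact (2 * k) * (deriv ^^ (2 * k - 1)) f (real n))
            - integral {real n..} (EM_remainder f M)))"

end

theory Submission
  imports Defs "HOL-Real_Asymp.Real_Asymp"
begin

text \<open>The expansion is the Euler--Maclaurin formula for \<open>f x = ln x ^ p / x ^ q\<close>, and it
  becomes explicit because \<open>f\<close> lives in a space that is closed under everything the formula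
  asks for. The functions \<open>(\<Sum>r\<le>p. c r * ln x ^ (p - r)) / x ^ s\<close> are mapped by differentiation to
  functions of the same shape with \<open>s\<close> raised by one. On the numerators, as polynomials in \<open>ln x\<close>,
  differentiating \<open>j\<close> times from \<open>s = q\<close> on is, up to the sign \<open>(-1) ^ j\<close> and the factor
  \<open>q * (q + 1) * \<dots> * (q + j - 1)\<close>, the operator \<open>(1 - D / q) * \<dots> * (1 - D / (q + j - 1))\<close>, where
  \<open>D\<close> is the formal derivative with respect to \<open>ln x\<close>. Expanding this product gives the
  elementary symmetric functions of the reciprocals
  \<open>1 / q, \<dots>, 1 / (q + j - 1)\<close>; these are the numbers \<open>S r q (q + j - 1)\<close>, and the whole
  content of \<open>log_poly_log_coeff_has_derivative\<close> is their Pascal-type recursion \<open>S_Suc_Suc\<close>.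
  The same derivative rule, run backwards, gives the tail integrals \<open>\<integral>\<^sub>a\<^sup>\<infinity> ln x ^ k / x ^ s\<close> in closed
  form (\<open>has_integral_log_tail\<close>), by an antiderivative whose derivative telescopes.

  For the constant term: all derivatives of \<open>f\<close> are absolutely integrable on \<open>{1..}\<close> and vanish
  at infinity. So the integrals over \<open>{1..n}\<close> in the finite Euler--Maclaurin formula
  (\<open>euler_maclaurin_finite\<close>) can be split as \<open>\<integral>\<^sub>1\<^sup>\<infinity> - \<integral>\<^sub>n\<^sup>\<infinity>\<close>, and everything that depends on \<open>n\<close>
  tends to \<open>0\<close>. For every order the constant that is left must therefore be the limit of the sums
  \<open>\<Sum>k=1..n. f k\<close> (\<open>EM_formal_constantI\<close>). This limit is \<open>(-1) ^ p\<close> times the \<open>p\<close>-th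
  derivative of zeta at \<open>q\<close>, because the Dirichlet series can be differentiated term by term
  (\<open>higher_deriv_zeta\<close>).

  At order \<open>m\<close> the error is, up to sign, exactly the tail of the remainder integral. The periodic Bernoulli
  function is bounded, so the tail is at most a combination of the explicit integrals
  \<open>\<integral>\<^sub>n\<^sup>\<infinity> ln x ^ (p - r) / x ^ (q + 2 * m + 1)\<close>, each of which is \<open>O(ln n ^ p / n ^ (q + 2 * m))\<close>.\<close>

section \<open>Bernoulli polynomials\<close>

declare bernoulli.simps(2) [simp del]

lemma bernoulli_sum: "(\<Sum>k\<le>Suc n. real ((n + 2) choose k) * bernoulli k) = 0"
proof -
  have "real ((n + 2) choose Suc n) = real (n + 2)"
    using binomial_symmetric[of "Suc n" "n + 2"] by simp
  then show ?thesis by (simp del: binomial_Suc_Suc add: field_simps bernoulli.simps(2))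
qed

lemma bernpoly_0: "bernpoly n 0 = bernoulli n"
proof -
  have "bernpoly n 0 = (\<Sum>k\<in>{n}. real (n choose k) * bernoulli k * 0 ^ (n - k))"
    unfolding bernpoly_def by (rule sum.mono_neutral_right) auto
  then show ?thesis by simp
qed

lemma bernpoly_1: "bernpoly (n + 2) 1 = bernoulli (n + 2)"
  using bernoulli_sum[of n] by (simp add: bernpoly_def del: binomial_Suc_Suc)

lemma bernpoly_has_derivative:
  "(bernpoly (Suc n) has_real_derivative real (Suc n) * bernpoly n x) (at x)"
proof -
  have "(bernpoly (Suc n) has_real_derivative
      (\<Sum>k\<le>Suc n. real (Suc n choose k) * bernoulli k * (real (Suc n - k) * x ^ (Suc n - k - 1)))) (at x)"
    unfolding bernpoly_def by (auto intro!: derivative_eq_intros sum.cong simp del: binomial_Suc_Suc of_nat_Suc)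
  also have "(\<Sum>k\<le>Suc n. real (Suc n choose k) * bernoulli k * (real (Suc n - k) * x ^ (Suc n - k - 1)))
      = (\<Sum>k\<le>n. real (Suc n) * (real (n choose k) * bernoulli k * x ^ (n - k)))"
  proof -
    have "real (Suc n choose k) * real (Suc n - k) = real (Suc n) * real (n choose k)" for k
      using binomial_absorb_comp[of "Suc n" k]
      by (metis diff_Suc_1 mult.commute of_nat_mult)
    then have termwise: "real (Suc n choose k) * bernoulli k * (real (Suc n - k) * x ^ (Suc n - k - 1))
        = real (Suc n) * (real (n choose k) * bernoulli k * x ^ (n - k))" for k
      by (simp del: binomial_Suc_Suc of_nat_Suc add: mult_ac)
    show ?thesis
      by (simp only: sum.atMost_Suc termwise) (simp add: binomial_eq_0 del: of_nat_Suc binomial_Suc_Suc)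
  qed
  finally show ?thesis by (simp only: bernpoly_def[of n] sum_distrib_left)
qed

text \<open>By induction on the degree. The difference \<open>D\<^sub>n\<close> of the two sides satisfies
  \<open>D\<^sub>n\<^sub>+\<^sub>1' = - (n + 1) * D\<^sub>n\<close>, so \<open>D\<^sub>n = 0\<close> only makes \<open>D\<^sub>n\<^sub>+\<^sub>1\<close> a constant \<open>c\<close>. That \<open>c\<close> vanishes is
  seen one degree higher: there the difference has constant slope \<open>- (n + 2) * c\<close>, yet it has equal
  values at \<open>0\<close> and \<open>1\<close>, where the Bernoulli polynomials of degree at least 2 agree.\<close>

lemma bernpoly_reflect: "bernpoly n (1 - x) = (-1) ^ n * bernpoly n x"
proof (induction n arbitrary: x)
  case 0
  show ?case by (simp add: bernpoly_def)
next
  case (Suc n)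
  define D where "D = (\<lambda>k x. bernpoly k (1 - x) - (-1) ^ k * bernpoly k x)"
  have deriv_D: "(D (Suc k) has_real_derivative - real (Suc k) * D k x) (at x)" for k x
    unfolding D_def
    by (auto intro!: derivative_eq_intros DERIV_chain2[of "bernpoly (Suc k)"] bernpoly_has_derivative
        simp: algebra_simps simp del: of_nat_Suc)
  have "D (Suc n) x = D (Suc n) 0" for x
  proof -
    have "(D (Suc n) has_real_derivative 0) (at x)" for x
      using deriv_D[of n x] Suc by (simp add: D_def)
    then show ?thesis using DERIV_isconst_all by blast
  qed
  then obtain c where c: "D (Suc n) x = c" for x by blast
  have "((\<lambda>x. D (Suc (Suc n)) x + real (n + 2) * c * x) has_real_derivative 0) (at x)" for x
    by (auto intro!: derivative_eq_intros deriv_D simp: c algebra_simps)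
  then have "D (Suc (Suc n)) 1 + real (n + 2) * c * 1 = D (Suc (Suc n)) 0 + real (n + 2) * c * 0"
    using DERIV_isconst_all by blast
  moreover have "D (Suc (Suc n)) 1 = D (Suc (Suc n)) 0"
    using bernpoly_1[of n] bernpoly_0[of "n + 2"] by (simp add: D_def)
  ultimately have "c = 0" by simp
  then show ?case using c[of x] by (simp add: D_def)
qed

text \<open>This is why only even orders appear in the Euler--Maclaurin formula: the boundary terms of
  every second integration by parts vanish from degree 3 on.\<close>

lemma bernoulli_odd_eq_0: "bernoulli (2 * k + 3) = 0"
proof -
  have "bernpoly (2 * k + 3) (1 - 0) = - bernpoly (2 * k + 3) 0"
    unfolding bernpoly_reflect by simp
  moreover have "bernpoly (2 * k + 3) 1 = bernoulli (2 * k + 3)"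
    using bernpoly_1[of "2 * k + 1"] by (simp add: numeral_3_eq_3)
  ultimately show ?thesis by (simp add: bernpoly_0)
qed

lemma continuous_on_bernpoly: "continuous_on A (bernpoly n)"
  unfolding bernpoly_def by (intro continuous_intros)

lemma bernpoly_bounded: "\<exists>K\<ge>0. \<forall>x. \<bar>bernpoly n (frac x)\<bar> \<le> K"
proof -
  have "compact (bernpoly n ` {0..1})"
    using continuous_on_bernpoly compact_Icc by (rule compact_continuous_image)
  then obtain K where K: "\<forall>y\<in>bernpoly n ` {0..1}. norm y \<le> K"
    using compact_imp_bounded bounded_iff by blast
  have "\<bar>bernpoly n (frac x)\<bar> \<le> K" for x
  proof -
    have "frac x \<in> {0..1}" using frac_ge_0[of x] frac_lt_1[of x] by simp
    then show ?thesis using K by auto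
  qed
  then show ?thesis by (metis abs_ge_zero order_trans)
qed

section \<open>The Euler--Maclaurin formula on a finite interval\<close>

text \<open>One integration by parts, stated for the sum of the two integrands so that neither needs an
  integrability hypothesis of its own.\<close>

lemma has_integral_bernpoly_shift:
  fixes G G' :: "real \<Rightarrow> real"
  assumes G: "\<And>x. a \<le> x \<Longrightarrow> (G has_real_derivative G' x) (at x)"
  shows "((\<lambda>x. bernpoly (Suc n) (x - a) / fact (Suc n) * G' x + bernpoly n (x - a) / fact n * G x)
    has_integral (bernpoly (Suc n) 1 * G (a + 1) - bernoulli (Suc n) * G a) / fact (Suc n)) {a..a + 1}"
proof -
  let ?H = "\<lambda>x. bernpoly (Suc n) (x - a) / fact (Suc n) * G x"
  have "(?H has_real_derivative
      bernpoly (Suc n) (x - a) / fact (Suc n) * G' x + bernpoly n (x - a) / fact n * G x) (at x)"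
    if "a \<le> x" for x
  proof -
    have "((\<lambda>x. bernpoly (Suc n) (x - a)) has_real_derivative
        real (Suc n) * bernpoly n (x - a) * (1 - 0)) (at x)"
      by (rule DERIV_chain2[OF bernpoly_has_derivative]) (intro DERIV_diff DERIV_ident DERIV_const)
    from DERIV_mult[OF DERIV_cdivide[OF this, of "fact (Suc n)"] G[OF that]]
    show ?thesis by (rule DERIV_cong) (simp add: mult_ac del: of_nat_Suc)
  qed
  then have "((\<lambda>x. bernpoly (Suc n) (x - a) / fact (Suc n) * G' x + bernpoly n (x - a) / fact n * G x)
      has_integral ?H (a + 1) - ?H a) {a..a + 1}"
    by (intro fundamental_theorem_of_calculus)
       (auto simp: has_real_derivative_iff_has_vector_derivative[symmetric]
             intro: has_field_derivative_at_within)
  moreover have "?H (a + 1) - ?H a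
      = (bernpoly (Suc n) 1 * G (a + 1) - bernoulli (Suc n) * G a) / fact (Suc n)"
    by (simp add: bernpoly_0 diff_divide_distrib)
  ultimately show ?thesis by simp
qed

text \<open>Each step of the induction integrates by parts twice: the step into odd degree has no boundary
  terms because the Bernoulli polynomial of degree \<open>2 * M + 3\<close> vanishes at both ends, and the step
  into even degree produces the new Bernoulli term.\<close>

lemma euler_maclaurin_unit_interval:
  fixes F :: "nat \<Rightarrow> real \<Rightarrow> real"
  assumes F: "\<And>j x. a \<le> x \<Longrightarrow> (F j has_real_derivative F (Suc j) x) (at x)"
  shows "((\<lambda>x. bernpoly (2 * M + 1) (x - a) / fact (2 * M + 1) * F (2 * M + 1) x) has_integral
    (F 0 a + F 0 (a + 1)) / 2 - integral {a..a + 1} (F 0)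
      - (\<Sum>k=1..M. bernoulli (2 * k) / fact (2 * k) * (F (2 * k - 1) (a + 1) - F (2 * k - 1) a)))
    {a..a + 1}"
proof (induction M)
  case 0
  have "continuous_on {a..a + 1} (F 0)"
    by (intro continuous_at_imp_continuous_on ballI DERIV_isCont[OF F]) simp
  then have "F 0 integrable_on {a..a + 1}"
    by (rule integrable_continuous_interval)
  then have "(F 0 has_integral integral {a..a + 1} (F 0)) {a..a + 1}"
    by (rule integrable_integral)
  from has_integral_diff[OF has_integral_bernpoly_shift[of a "F 0" "F (Suc 0)" 0, OF F] this]
  have "((\<lambda>x. bernpoly 1 (x - a) * F 1 x) has_integral
      bernpoly 1 1 * F 0 (a + 1) - bernoulli 1 * F 0 a - integral {a..a + 1} (F 0)) {a..a + 1}"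
    by (simp add: bernpoly_def)
  moreover have "bernpoly 1 1 = 1 / 2" "bernoulli 1 = - 1 / 2"
    by (simp_all add: bernpoly_def bernoulli.simps(2))
  ultimately have "((\<lambda>x. bernpoly 1 (x - a) * F 1 x) has_integral
      1 / 2 * F 0 (a + 1) - - 1 / 2 * F 0 a - integral {a..a + 1} (F 0)) {a..a + 1}"
    by (simp only:)
  then show ?case by (simp add: add_divide_distrib add.commute)
next
  case (Suc M)
  let ?b = "\<lambda>n x. bernpoly n (x - a) / fact n * F n x"
  let ?B = "bernoulli (2 * M + 2) / fact (2 * M + 2) * (F (2 * M + 1) (a + 1) - F (2 * M + 1) a)"
  have even_step: "((\<lambda>x. ?b (2 * M + 2) x + ?b (2 * M + 1) x) has_integral ?B) {a..a + 1}"
    using has_integral_bernpoly_shift[of a "F (2 * M + 1)" "F (2 * M + 2)" "2 * M + 1"]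
      F[of _ "2 * M + 1"] bernpoly_1[of "2 * M"]
    by (simp add: algebra_simps diff_divide_distrib)
  have "bernpoly (2 * M + 3) 1 = 0" "bernoulli (2 * M + 3) = 0"
    using bernpoly_1[of "2 * M + 1"] bernoulli_odd_eq_0[of M] by (simp_all add: numeral_3_eq_3)
  then have odd_step: "((\<lambda>x. ?b (2 * M + 3) x + ?b (2 * M + 2) x) has_integral 0) {a..a + 1}"
    using has_integral_bernpoly_shift[of a "F (2 * M + 2)" "F (2 * M + 3)" "2 * M + 2"]
      F[of _ "2 * M + 2"]
    by (simp add: numeral_3_eq_3)
  let ?s = "\<lambda>k. bernoulli (2 * k) / fact (2 * k) * (F (2 * k - 1) (a + 1) - F (2 * k - 1) a)"
  have sum_step: "(\<Sum>k=1..Suc M. ?s k) = (\<Sum>k=1..M. ?s k) + ?B"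
    by (simp add: sum.cl_ivl_Suc del: fact_Suc)
  have "(?b (2 * M + 3) has_integral
      0 - ?B + ((F 0 a + F 0 (a + 1)) / 2 - integral {a..a + 1} (F 0) - (\<Sum>k=1..M. ?s k))) {a..a + 1}"
    by (rule has_integral_eq[OF _ has_integral_add[OF has_integral_diff[OF odd_step even_step] Suc]])
       (simp only: diff_add_eq add_diff_cancel_left' add_diff_cancel_right diff_add_cancel)
  then have "(?b (2 * M + 3) has_integral (F 0 a + F 0 (a + 1)) / 2 - integral {a..a + 1} (F 0)
      - (\<Sum>k=1..Suc M. ?s k)) {a..a + 1}"
    by (rule has_integral_eq_rhs) (use sum_step in linarith)
  moreover have "2 * Suc M + 1 = 2 * M + 3" by simp
  ultimately show ?case by (simp only:)
qed

lemma euler_maclaurin_finite: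
  fixes F :: "nat \<Rightarrow> real \<Rightarrow> real" and n :: nat
  assumes F: "\<And>j x. 1 \<le> x \<Longrightarrow> (F j has_real_derivative F (Suc j) x) (at x)"
    and "1 \<le> n"
  shows "((\<lambda>x. bernpoly (2 * M + 1) (frac x) / fact (2 * M + 1) * F (2 * M + 1) x) has_integral
    (\<Sum>k=1..n. F 0 (real k)) - (F 0 1 + F 0 (real n)) / 2 - integral {1..real n} (F 0)
      - (\<Sum>k=1..M. bernoulli (2 * k) / fact (2 * k) * (F (2 * k - 1) (real n) - F (2 * k - 1) 1)))
    {1..real n}"
  using \<open>1 \<le> n\<close>
proof (induction n rule: dec_induct)
  case base
  then show ?case by (simp add: has_integral_refl(2)[of _ 1, simplified])
next
  case (step n)
  let ?R = "\<lambda>x. bernpoly (2 * M + 1) (frac x) / fact (2 * M + 1) * F (2 * M + 1) x"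
  define T where "T = (\<lambda>x. \<Sum>k=1..M. bernoulli (2 * k) / fact (2 * k) * F (2 * k - 1) x)"
  have T: "(\<Sum>k=1..M. bernoulli (2 * k) / fact (2 * k) * (F (2 * k - 1) y - F (2 * k - 1) x))
      = T y - T x" for x y
    by (simp add: T_def sum_subtractf right_diff_distrib)
  \<comment> \<open>On \<open>[n, n + 1]\<close> the fractional part is \<open>x - n\<close>, except at the right end, where it jumps to 0.\<close>
  have unit: "(?R has_integral (F 0 (real n) + F 0 (real n + 1)) / 2
      - integral {real n..real n + 1} (F 0) - (T (real n + 1) - T (real n))) {real n..real n + 1}"
  proof (rule has_integral_spike_finite[of "{real n + 1}"])
    show "?R x = bernpoly (2 * M + 1) (x - real n) / fact (2 * M + 1) * F (2 * M + 1) x"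
      if "x \<in> {real n..real n + 1} - {real n + 1}" for x
    proof -
      have "\<lfloor>x\<rfloor> = int n" using that by (simp add: floor_eq_iff)
      then have "frac x = x - real n" by (simp add: frac_def)
      then show ?thesis by (simp only:)
    qed
    show "((\<lambda>x. bernpoly (2 * M + 1) (x - real n) / fact (2 * M + 1) * F (2 * M + 1) x) has_integral
        (F 0 (real n) + F 0 (real n + 1)) / 2
      - integral {real n..real n + 1} (F 0) - (T (real n + 1) - T (real n))) {real n..real n + 1}"
      using euler_maclaurin_unit_interval[of "real n" F M] F step unfolding T by simp
  qed simp
  have "continuous_on {1..real n + 1} (F 0)"
    by (intro continuous_at_imp_continuous_on ballI DERIV_isCont[OF F]) simp
  then have interval_split: "integral {1..real n} (F 0) + integral {real n..real n + 1} (F 0)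
      = integral {1..real n + 1} (F 0)"
    using step by (intro Henstock_Kurzweil_Integration.integral_combine integrable_continuous_interval) auto
  have "1 \<le> real n" "real n \<le> real n + 1" using step by simp_all
  from has_integral_combine[OF this step.IH[unfolded T] unit]
  have "(?R has_integral (\<Sum>k=1..Suc n. F 0 (real k)) - (F 0 1 + F 0 (real n + 1)) / 2
      - integral {1..real n + 1} (F 0) - (T (real n + 1) - T 1)) {1..real n + 1}"
    by (rule has_integral_eq_rhs)
       (use interval_split step(1) in \<open>simp add: sum.cl_ivl_Suc add_divide_distrib algebra_simps\<close>)
  then show ?case
    unfolding T by (simp only: of_nat_Suc add.commute)
qed

section \<open>The Euler--Maclaurin formula up to infinity\<close>

text \<open>Iterated \<^const>\<open>deriv\<close> is awkward to compute with, since it is \<open>deriv\<close> of a function known only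
  on part of the type. Openness of \<open>A\<close> lets a chain of derivatives known on \<open>A\<close> be substituted
  for it. The lemma is applied both to real functions and to zeta.\<close>

lemma higher_deriv_eq:
  fixes F :: "nat \<Rightarrow> 'a::real_normed_field \<Rightarrow> 'a"
  assumes "open A" and F: "\<And>j x. x \<in> A \<Longrightarrow> (F j has_field_derivative F (Suc j) x) (at x)"
    and "x \<in> A"
  shows "(deriv ^^ j) (F 0) x = F j x"
  using \<open>x \<in> A\<close>
proof (induction j arbitrary: x)
  case (Suc j)
  have "\<forall>\<^sub>F y in nhds x. (deriv ^^ j) (F 0) y = F j y"
    using eventually_nhds_in_open[OF \<open>open A\<close> Suc.prems] by eventually_elim (rule Suc.IH)
  then have "deriv ((deriv ^^ j) (F 0)) x = deriv (F j) x"
    by (rule deriv_cong_ev) simp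
  also have "\<dots> = F (Suc j) x"
    by (rule DERIV_imp_deriv) (rule F[OF Suc.prems])
  finally show ?case by simp
qed simp

lemma integral_tail_split:
  fixes h :: "real \<Rightarrow> real"
  assumes "h absolutely_integrable_on {a..}" and "a \<le> b"
  shows "h absolutely_integrable_on {b..}" "h absolutely_integrable_on {a..b}"
    "integral {a..} h = integral {a..b} h + integral {b..} h"
proof -
  show 1: "h absolutely_integrable_on {b..}" "h absolutely_integrable_on {a..b}"
    using assms by (auto intro: set_integrable_subset)
  then have "(h has_integral integral {a..b} h + integral {b..} h) ({a..b} \<union> {b..})"
    using \<open>a \<le> b\<close>
    by (intro has_integral_Un integrable_integral set_lebesgue_integral_eq_integral(1))
       (auto intro: negligible_subset[of "{b}"])
  moreover have "{a..b} \<union> {b..} = {a..}" using \<open>a \<le> b\<close> by auto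
  ultimately show "integral {a..} h = integral {a..b} h + integral {b..} h"
    by (simp add: integral_unique)
qed

lemma integral_tail_tendsto_0:
  fixes h :: "real \<Rightarrow> real"
  assumes h: "h absolutely_integrable_on {a..}"
  shows "((\<lambda>b. integral {b..} h) \<longlongrightarrow> 0) at_top"
proof -
  have "((\<lambda>b. LINT x:{a..b}|lebesgue. h x) \<longlongrightarrow> (LINT x:{a..}|lebesgue. h x)) at_top"
    using h by (intro tendsto_set_lebesgue_integral_at_top) auto
  then have "((\<lambda>b. (LINT x:{a..}|lebesgue. h x) - (LINT x:{a..b}|lebesgue. h x)) \<longlongrightarrow> 0) at_top"
    by (auto intro: tendsto_eq_intros)
  moreover have "\<forall>\<^sub>F b in at_top.
      (LINT x:{a..}|lebesgue. h x) - (LINT x:{a..b}|lebesgue. h x) = integral {b..} h"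
    using eventually_ge_at_top[of a]
  proof eventually_elim
    case (elim b)
    then show ?case
      using integral_tail_split[OF h elim] h by (simp add: set_lebesgue_integral_eq_integral(2))
  qed
  ultimately show ?thesis by (rule Lim_transform_eventually)
qed

lemma borel_measurable_bernpoly_frac: "(\<lambda>x. bernpoly n (frac x)) \<in> borel_measurable borel"
proof -
  have "bernpoly n \<in> borel_measurable borel"
    by (rule borel_measurable_continuous_onI) (rule continuous_on_bernpoly)
  moreover have "(frac :: real \<Rightarrow> real) \<in> borel_measurable borel"
    unfolding frac_def by measurable
  ultimately show ?thesis by (rule measurable_compose[rotated])
qed

text \<open>For the improper form, \<open>F j\<close> stands for the \<open>j\<close>-th derivative of \<open>F 0\<close>. It is differentiable
  on \<open>{0<..}\<close> and not just on \<open>{1..}\<close>, so that iterated \<^const>\<open>deriv\<close> is determined at the endpoint \<open>1\<close>,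
  too.\<close>

context
  fixes F :: "nat \<Rightarrow> real \<Rightarrow> real"
  assumes F: "\<And>j x. 0 < x \<Longrightarrow> (F j has_real_derivative F (Suc j) x) (at x)"
    and F_abs: "\<And>j. F j absolutely_integrable_on {1..}"
begin

lemma EM_remainder_eq:
  assumes "0 < x"
  shows "EM_remainder (F 0) M x = bernpoly (2 * M + 1) (frac x) / fact (2 * M + 1) * F (2 * M + 1) x"
  using higher_deriv_eq[of "{0<..}" F x "2 * M + 1"] F assms by (simp add: EM_remainder_def)

lemma EM_remainder_bound:
  "\<exists>K\<ge>0. \<forall>x>0. \<bar>EM_remainder (F 0) M x\<bar> \<le> K * \<bar>F (2 * M + 1) x\<bar>"
proof -
  obtain K where K: "K \<ge> 0" "\<And>x. \<bar>bernpoly (2 * M + 1) (frac x)\<bar> \<le> K"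
    using bernpoly_bounded by blast
  have "\<bar>EM_remainder (F 0) M x\<bar> \<le> K / fact (2 * M + 1) * \<bar>F (2 * M + 1) x\<bar>" if "0 < x" for x
    unfolding EM_remainder_eq[OF that] abs_mult abs_divide abs_of_nonneg[OF fact_ge_zero]
    by (intro mult_right_mono divide_right_mono K) auto
  moreover have "K / fact (2 * M + 1) \<ge> 0" using K by simp
  ultimately show ?thesis by blast
qed

lemma EM_remainder_absolutely_integrable:
  "EM_remainder (F 0) M absolutely_integrable_on {1..}"
proof -
  let ?b = "\<lambda>x::real. bernpoly (2 * M + 1) (frac x) / fact (2 * M + 1)"
  obtain K where K: "K \<ge> 0" "\<And>x. \<bar>bernpoly (2 * M + 1) (frac x)\<bar> \<le> K"
    using bernpoly_bounded by blast
  have "?b \<in> borel_measurable borel"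
    using borel_measurable_bernpoly_frac by measurable
  then have "?b \<in> borel_measurable (lebesgue_on {1..})"
    by (intro measurable_restrict_space1 borel_measurable_if_I measurable_completion) simp
  moreover have "bounded (?b ` {1..})"
    unfolding bounded_iff using K
    by (intro exI[of _ "K / fact (2 * M + 1)"]) (auto intro!: divide_right_mono simp del: fact_Suc)
  ultimately have "(\<lambda>x. ?b x * F (2 * M + 1) x) absolutely_integrable_on {1..}"
    using F_abs by (intro absolutely_integrable_bounded_measurable_product_real) auto
  then show ?thesis
    by (rule absolutely_integrable_spike[of _ _ "{}"]) (auto simp: EM_remainder_eq)
qed

lemma euler_maclaurin:
  fixes n :: nat
  assumes "1 \<le> n"
  shows "(\<Sum>k=1..n. F 0 (real k)) =
    (integral {1..} (F 0) + F 0 1 / 2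
      - (\<Sum>k=1..M. bernoulli (2 * k) / fact (2 * k) * F (2 * k - 1) 1)
      + integral {1..} (EM_remainder (F 0) M))
    - integral {real n..} (F 0) + F 0 (real n) / 2
    + (\<Sum>k=1..M. bernoulli (2 * k) / fact (2 * k) * F (2 * k - 1) (real n))
    - integral {real n..} (EM_remainder (F 0) M)"
proof -
  have "integral {1..real n} (EM_remainder (F 0) M)
      = integral {1..real n} (\<lambda>x. bernpoly (2 * M + 1) (frac x) / fact (2 * M + 1) * F (2 * M + 1) x)"
    by (rule integral_cong) (simp only: EM_remainder_eq atLeastAtMost_iff, subst EM_remainder_eq, auto)
  also have "\<dots> = (\<Sum>k=1..n. F 0 (real k)) - (F 0 1 + F 0 (real n)) / 2 - integral {1..real n} (F 0)
      - (\<Sum>k=1..M. bernoulli (2 * k) / fact (2 * k) * (F (2 * k - 1) (real n) - F (2 * k - 1) 1))"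
    using F assms by (intro integral_unique euler_maclaurin_finite) auto
  finally show ?thesis
    using integral_tail_split(3)[OF F_abs[of 0], of "real n"] assms
      integral_tail_split(3)[OF EM_remainder_absolutely_integrable[of M], of "real n"]
    by (simp add: right_diff_distrib sum_subtractf add_divide_distrib)
qed

text \<open>The constant in the formula of order \<open>M\<close> is pinned down without evaluating any integral: it
  is the only term that survives as \<open>n\<close> grows, so it equals the limit \<open>c\<close> of the sums, whatever
  \<open>M\<close> is.\<close>

lemma EM_formal_constantI:
  assumes F_lim: "\<And>j. (F j \<longlongrightarrow> 0) at_top"
    and c: "(\<lambda>n. \<Sum>k=1..n. F 0 (real k)) \<longlonglongrightarrow> c"
    and a: "\<And>k. a k = (if k = 0 then integral {1..} (F 0) + F 0 1 / 2
        else - (bernoulli (2 * k) / fact (2 * k) * F (2 * k - 1) 1))"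
  shows "EM_formal_constant (F 0) c a"
proof -
  have deriv_F: "(deriv ^^ j) (F 0) x = F j x" if "0 < x" for j x
    using higher_deriv_eq[of "{0<..}" F x j] F that by simp
  have diff: "(deriv ^^ j) (F 0) differentiable at x" if "1 \<le> x" for j x
  proof -
    have "(F j has_derivative (*) (F (Suc j) x)) (at x)"
      using F[of x j] that by (simp add: has_field_derivative_def)
    then have "((deriv ^^ j) (F 0) has_derivative (*) (F (Suc j) x)) (at x)"
      by (rule has_derivative_transform_within_open[of _ _ _ _ "{0<..}"]) (use that deriv_F in auto)
    then show ?thesis unfolding differentiable_def by blast
  qed
  define C where "C M = (\<Sum>k\<le>M. a k) + integral {1..} (EM_remainder (F 0) M)" for M
  have C: "C M = integral {1..} (F 0) + F 0 1 / 2
      - (\<Sum>k=1..M. bernoulli (2 * k) / fact (2 * k) * F (2 * k - 1) 1)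
      + integral {1..} (EM_remainder (F 0) M)" for M
    unfolding C_def by (simp add: a atMost_atLeast0 sum.atLeast_Suc_atMost sum_negf)
  have EM: "(\<Sum>k=1..n. F 0 (real k)) = C M
      - integral {real n..} (F 0) + F 0 (real n) / 2
      + (\<Sum>k=1..M. bernoulli (2 * k) / fact (2 * k) * F (2 * k - 1) (real n))
      - integral {real n..} (EM_remainder (F 0) M)" if "1 \<le> n" for n M
    unfolding C using that by (rule euler_maclaurin)
  have "C M = c" for M
  proof -
    have "((\<lambda>x. C M - integral {x..} (F 0) + F 0 x / 2
        + (\<Sum>k=1..M. bernoulli (2 * k) / fact (2 * k) * F (2 * k - 1) x)
        - integral {x..} (EM_remainder (F 0) M)) \<longlongrightarrow>
        C M - 0 + 0 / 2 + (\<Sum>k=1..M. bernoulli (2 * k) / fact (2 * k) * 0) - 0) at_top"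
      by (intro tendsto_intros F_lim integral_tail_tendsto_0[OF F_abs]
          integral_tail_tendsto_0[OF EM_remainder_absolutely_integrable]) simp
    from filterlim_compose[OF this filterlim_real_sequentially]
    have "(\<lambda>n. C M - integral {real n..} (F 0) + F 0 (real n) / 2
        + (\<Sum>k=1..M. bernoulli (2 * k) / fact (2 * k) * F (2 * k - 1) (real n))
        - integral {real n..} (EM_remainder (F 0) M)) \<longlonglongrightarrow> C M" by simp
    then have "(\<lambda>n. \<Sum>k=1..n. F 0 (real k)) \<longlonglongrightarrow> C M"
      by (rule Lim_transform_eventually)
         (use eventually_ge_at_top[of "1::nat"] in eventually_elim, simp only: EM[of _ M])
    with c show ?thesis using LIMSEQ_unique by blast
  qed
  then have EM': "(\<Sum>k=1..n. F 0 (real k)) = c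
      - integral {real n..} (F 0) + F 0 (real n) / 2
      + (\<Sum>k=1..M. bernoulli (2 * k) / fact (2 * k) * (deriv ^^ (2 * k - 1)) (F 0) (real n))
      - integral {real n..} (EM_remainder (F 0) M)" if "1 \<le> n" for n M
    using EM[OF that, of M] that by (simp add: deriv_F)
  show ?thesis
    unfolding EM_formal_constant_def
  proof (intro conjI allI impI)
    show "F 0 integrable_on {1..}" "EM_remainder (F 0) M integrable_on {1..}" for M
      using F_abs EM_remainder_absolutely_integrable by (auto intro: set_lebesgue_integral_eq_integral(1))
    show "c = (\<Sum>k\<le>M. a k) + integral {1..} (EM_remainder (F 0) M)" for M
      using \<open>C M = c\<close> by (simp add: C_def)
    show "a k = - (bernoulli (2 * k) / fact (2 * k) * (deriv ^^ (2 * k - 1)) (F 0) 1)" if "1 \<le> k" for k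
      using that by (simp add: a deriv_F)
  qed (use diff EM' in \<open>simp_all add: a\<close>)
qed

end

section \<open>Polynomials in the logarithm over a power\<close>

definition log_poly :: "(nat \<Rightarrow> real) \<Rightarrow> nat \<Rightarrow> nat \<Rightarrow> real \<Rightarrow> real" where
  "log_poly c p s x = (\<Sum>r=0..p. c r * ln x ^ (p - r)) / x ^ s"

text \<open>The rule is stated as a condition on a candidate \<open>c'\<close>, and only up to index \<open>p\<close>: closed forms
  for \<open>c'\<close> can then be checked by a recursion, whatever they give beyond \<open>p\<close>.\<close>

lemma log_poly_has_derivative:
  assumes "0 < x"
    and c': "c' 0 = - real s * c 0"
      "\<And>r. r < p \<Longrightarrow> c' (Suc r) = real (p - r) * c r - real s * c (Suc r)"
  shows "(log_poly c p s has_real_derivative log_poly c' p (Suc s) x) (at x)"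
proof -
  let ?L = "ln x"
  have num: "(\<Sum>r=0..p. c' r * ?L ^ (p - r))
      = (\<Sum>r=0..p. c r * (real (p - r) * ?L ^ (p - r - 1))) - real s * (\<Sum>r=0..p. c r * ?L ^ (p - r))"
  proof (cases p)
    case 0
    then show ?thesis using c'(1) by simp
  next
    case (Suc m)
    have "(\<Sum>r=0..p. c' r * ?L ^ (p - r)) = c' 0 * ?L ^ p + (\<Sum>r=0..m. c' (Suc r) * ?L ^ (m - r))"
      unfolding Suc by (subst sum.atLeast0_atMost_Suc_shift) simp
    also have "(\<Sum>r=0..m. c' (Suc r) * ?L ^ (m - r))
        = (\<Sum>r=0..m. c r * (real (p - r) * ?L ^ (m - r)) - real s * (c (Suc r) * ?L ^ (m - r)))"
      by (rule sum.cong) (simp_all add: c'(2) Suc algebra_simps)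
    also have "\<dots> = (\<Sum>r=0..m. c r * (real (p - r) * ?L ^ (m - r)))
        - real s * (\<Sum>r=0..m. c (Suc r) * ?L ^ (m - r))"
      by (simp add: sum_subtractf sum_distrib_left)
    also have "(\<Sum>r=0..m. c r * (real (p - r) * ?L ^ (m - r)))
        = (\<Sum>r=0..p. c r * (real (p - r) * ?L ^ (p - r - 1)))"
      unfolding Suc by (subst sum.atLeast0_atMost_Suc) (auto intro!: sum.cong)
    also have "(\<Sum>r=0..m. c (Suc r) * ?L ^ (m - r))
        = (\<Sum>r=0..p. c r * ?L ^ (p - r)) - c 0 * ?L ^ p"
      unfolding Suc sum.atLeast0_atMost_Suc_shift by simp
    finally show ?thesis by (simp add: c'(1) algebra_simps)
  qed
  have num_deriv: "((\<lambda>x. \<Sum>r=0..p. c r * ln x ^ (p - r)) has_real_derivative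
      (\<Sum>r=0..p. c r * (real (p - r) * ?L ^ (p - r - 1))) / x) (at x)"
    unfolding sum_divide_distrib using \<open>0 < x\<close>
    by (auto intro!: derivative_eq_intros sum.cong)
  have pow: "((\<lambda>x. x ^ s) has_real_derivative real s * x ^ (s - 1)) (at x)"
    by (auto intro!: derivative_eq_intros)
  have "(log_poly c p s has_real_derivative
      ((\<Sum>r=0..p. c r * (real (p - r) * ?L ^ (p - r - 1))) / x * x ^ s
        - (\<Sum>r=0..p. c r * ?L ^ (p - r)) * (real s * x ^ (s - 1))) / (x ^ s * x ^ s)) (at x)"
    unfolding log_poly_def[abs_def] using \<open>0 < x\<close> by (intro DERIV_divide num_deriv pow) simp
  moreover have "(A / x * x ^ s - B * (real s * x ^ (s - 1))) / (x ^ s * x ^ s)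
      = (A - real s * B) / x ^ Suc s" for A B
    using \<open>0 < x\<close> by (cases s) (simp_all add: field_simps)
  ultimately show ?thesis
    unfolding log_poly_def num by simp
qed

lemma ln_power_over_power_tendsto_0:
  assumes "0 < s"
  shows "((\<lambda>x::real. ln x ^ k / x ^ s) \<longlongrightarrow> 0) at_top"
  using assms by real_asymp

lemma log_poly_tendsto_0:
  assumes "0 < s"
  shows "(log_poly c p s \<longlongrightarrow> 0) at_top"
proof -
  have "((\<lambda>x. \<Sum>r=0..p. c r * (ln x ^ (p - r) / x ^ s)) \<longlongrightarrow> (\<Sum>r=0..p. c r * 0)) at_top"
    using assms by (intro tendsto_intros ln_power_over_power_tendsto_0)
  then show ?thesis by (simp add: log_poly_def[abs_def] sum_divide_distrib)
qed

lemma log_poly_bigo: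
  assumes "k \<le> p"
  shows "log_poly c k s \<in> O(\<lambda>x. ln x ^ p / x ^ s)"
proof -
  have "(\<lambda>x. ln x ^ (k - r)) \<in> O(\<lambda>x::real. ln x ^ p)" for r
  proof (rule bigoI[of _ 1])
    show "\<forall>\<^sub>F x::real in at_top. norm (ln x ^ (k - r)) \<le> 1 * norm (ln x ^ p)"
      using eventually_ge_at_top[of "exp 1 :: real"]
    proof eventually_elim
      case (elim x)
      then have "1 \<le> ln x" by (meson exp_gt_zero ln_ge_iff order_less_le_trans)
      then show ?case using assms by (simp add: power_increasing)
    qed
  qed
  then have "(\<lambda>x. c r * ln x ^ (k - r)) \<in> O(\<lambda>x. ln x ^ p)" for r
    by (cases "c r = 0") simp_all
  then have "(\<lambda>x. \<Sum>r=0..k. c r * ln x ^ (k - r)) \<in> O(\<lambda>x. ln x ^ p)"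
    by (intro big_sum_in_bigo)
  then have "(\<lambda>x. (\<Sum>r=0..k. c r * ln x ^ (k - r)) * inverse (x ^ s)) \<in> O(\<lambda>x. ln x ^ p * inverse (x ^ s))"
    by (intro landau_o.big.mult_right)
  then show ?thesis by (simp only: log_poly_def[abs_def] divide_inverse)
qed

text \<open>For \<open>s \<ge> 2\<close> and \<open>x \<ge> 1\<close> this is \<open>\<integral>\<^sub>x\<^sup>\<infinity> ln t ^ k / t ^ s\<close>. Each integration by parts lowers the
  power of the logarithm by one; \<open>k\<close> of them produce the sum.\<close>

definition log_tail :: "nat \<Rightarrow> nat \<Rightarrow> real \<Rightarrow> real" where
  "log_tail k s = log_poly (\<lambda>r. fact k / (fact (k - r) * (real s - 1) ^ (r + 1))) k (s - 1)"

lemma log_tail_has_derivative: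
  assumes "2 \<le> s" "0 < x"
  shows "(log_tail k s has_real_derivative - (ln x ^ k / x ^ s)) (at x)"
proof -
  \<comment> \<open>The coefficients telescope: only the leading power of the logarithm survives differentiation.\<close>
  let ?c' = "\<lambda>r::nat. if r = 0 then - 1 else 0 :: real"
  have s: "real (s - 1) = real s - 1" "real s - 1 \<noteq> 0" using assms by auto
  have "(log_tail k s has_real_derivative log_poly ?c' k (Suc (s - 1)) x) (at x)"
    unfolding log_tail_def
  proof (rule log_poly_has_derivative[OF \<open>0 < x\<close>])
    fix r assume "r < k"
    then obtain w where w: "k - r = Suc w" "k - Suc r = w"
      by (metis Suc_diff_Suc)
    show "?c' (Suc r)
        = real (k - r) * (fact k / (fact (k - r) * (real s - 1) ^ (r + 1)))
          - real (s - 1) * (fact k / (fact (k - Suc r) * (real s - 1) ^ (Suc r + 1)))"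
    proof -
      have "0 = real (Suc w) * (c / (real (Suc w) * fact w * u ^ (r + 1)))
          - u * (c / (fact w * u ^ (Suc r + 1)))" if "u \<noteq> 0" for c u :: real
        using that by (simp add: field_simps del: of_nat_Suc)
      from this[OF s(2), of "fact k"] show ?thesis
        unfolding w s(1) fact_Suc by simp
    qed
  qed (use s in \<open>simp add: field_simps\<close>)
  moreover have "log_poly ?c' k (Suc (s - 1)) x = - (ln x ^ k / x ^ s)"
    using assms by (simp add: log_poly_def if_distrib[of "\<lambda>c. c * _"] cong: if_cong)
  ultimately show ?thesis by simp
qed

lemma has_integral_log_tail:
  assumes "2 \<le> s" "1 \<le> a"
  shows "((\<lambda>x. ln x ^ k / x ^ s) has_integral log_tail k s a) {a..}"
proof (rule has_integral_to_inf)
  have int: "((\<lambda>x. ln x ^ k / x ^ s) has_integral - log_tail k s y - - log_tail k s a) {a..y}"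
    if "a \<le> y" for y
  proof (rule fundamental_theorem_of_calculus[OF that])
    fix x assume "x \<in> {a..y}"
    then have "0 < x" using assms by simp
    from DERIV_minus[OF has_field_derivative_at_within[OF log_tail_has_derivative[OF assms(1) this]]]
    show "((\<lambda>x. - log_tail k s x) has_vector_derivative ln x ^ k / x ^ s) (at x within {a..y})"
      by (simp add: has_real_derivative_iff_has_vector_derivative)
  qed
  show "(\<lambda>x. ln x ^ k / x ^ s) integrable_on {a..y}" for y
    by (cases "a \<le> y") (simp_all add: has_integral_integrable[OF int] integrable_on_empty)
  have "((\<lambda>y. - log_tail k s y - - log_tail k s a) \<longlongrightarrow> - 0 - - log_tail k s a) at_top"
    unfolding log_tail_def using assms by (intro tendsto_intros log_poly_tendsto_0) simp
  moreover have "\<forall>\<^sub>F y in at_top. - log_tail k s y - - log_tail k s a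
      = integral {a..y} (\<lambda>x. ln x ^ k / x ^ s)"
    using eventually_ge_at_top[of a] by eventually_elim (rule integral_unique[OF int, symmetric])
  ultimately show "((\<lambda>y. integral {a..y} (\<lambda>x. ln x ^ k / x ^ s)) \<longlongrightarrow> log_tail k s a) at_top"
    by (auto dest: Lim_transform_eventually)
qed (use assms in auto)

lemma log_power_absolutely_integrable:
  assumes "2 \<le> s" "1 \<le> a"
  shows "(\<lambda>x::real. ln x ^ k / x ^ s) absolutely_integrable_on {a..}"
  using has_integral_log_tail[OF assms] assms
  by (intro nonnegative_absolutely_integrable_1) (auto simp: integrable_on_def)

lemma log_poly_absolutely_integrable:
  assumes "2 \<le> s" "1 \<le> a"
  shows "log_poly c p s absolutely_integrable_on {a..}"
proof -
  have "(\<lambda>x. \<Sum>r=0..p. c r * (ln x ^ (p - r) / x ^ s)) absolutely_integrable_on {a..}"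
    using assms by (intro absolutely_integrable_sum set_integrable_mult_right log_power_absolutely_integrable) auto
  then show ?thesis by (simp add: log_poly_def[abs_def] sum_divide_distrib)
qed

lemma integral_abs_log_poly_le:
  assumes "2 \<le> s" "1 \<le> a"
  shows "integral {a..} (\<lambda>x. \<bar>log_poly c p s x\<bar>) \<le> (\<Sum>r=0..p. \<bar>c r\<bar> * log_tail (p - r) s a)"
proof (rule has_integral_le)
  show "((\<lambda>x. \<bar>log_poly c p s x\<bar>) has_integral integral {a..} (\<lambda>x. \<bar>log_poly c p s x\<bar>)) {a..}"
    using log_poly_absolutely_integrable[OF assms, of c p]
    by (intro integrable_integral) (simp add: absolutely_integrable_on_def)
  show "((\<lambda>x. \<Sum>r=0..p. \<bar>c r\<bar> * (ln x ^ (p - r) / x ^ s)) has_integral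
      (\<Sum>r=0..p. \<bar>c r\<bar> * log_tail (p - r) s a)) {a..}"
    using assms by (intro has_integral_sum has_integral_mult_right has_integral_log_tail) auto
  show "\<bar>log_poly c p s x\<bar> \<le> (\<Sum>r=0..p. \<bar>c r\<bar> * (ln x ^ (p - r) / x ^ s))" if "x \<in> {a..}" for x
    unfolding log_poly_def sum_divide_distrib using that assms
    by (intro order_trans[OF sum_abs] sum_mono) (simp add: abs_mult)
qed

section \<open>Higher derivatives of logarithmic powers\<close>

lemma S_0: "S 0 s t = 1"
proof -
  have "{I. I \<subseteq> {s..t} \<and> card I = 0} = {{}}"
    by (auto simp: card_eq_0_iff dest: finite_subset[OF _ finite_atLeastAtMost])
  then show ?thesis by (simp add: S_def)
qed

lemma S_Suc_empty: "t < s \<Longrightarrow> S (Suc r) s t = 0"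
  by (auto simp: S_def)

text \<open>Sort the subsets of \<open>{s..Suc t}\<close> by whether they contain the largest element \<open>Suc t\<close>.\<close>

lemma S_Suc_Suc:
  assumes "s \<le> Suc t"
  shows "S (Suc r) s (Suc t) = S (Suc r) s t + S r s t / real (Suc t)"
proof -
  let ?A = "\<lambda>r t. {I. I \<subseteq> {s..t} \<and> card I = r}"
  have fin: "finite I" if "I \<subseteq> {s..t}" for I t using that finite_subset by blast
  have family_split: "?A (Suc r) (Suc t) = ?A (Suc r) t \<union> insert (Suc t) ` ?A r t"
  proof (intro equalityI subsetI)
    fix I assume I: "I \<in> ?A (Suc r) (Suc t)"
    show "I \<in> ?A (Suc r) t \<union> insert (Suc t) ` ?A r t"
    proof (cases "Suc t \<in> I")
      case True
      then have "I = insert (Suc t) (I - {Suc t})" by blast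
      moreover have "I - {Suc t} \<in> ?A r t"
        using I True fin[of I "Suc t"] by (auto simp: le_Suc_eq subset_iff)
      ultimately show ?thesis by blast
    next
      case False
      then have "I \<in> ?A (Suc r) t" using I by (auto simp: le_Suc_eq subset_iff)
      then show ?thesis by blast
    qed
  next
    fix I assume "I \<in> ?A (Suc r) t \<union> insert (Suc t) ` ?A r t"
    then show "I \<in> ?A (Suc r) (Suc t)"
    proof
      assume "I \<in> insert (Suc t) ` ?A r t"
      then obtain J where J: "I = insert (Suc t) J" "J \<subseteq> {s..t}" "card J = r" by blast
      then have "Suc t \<notin> J" "finite J" using fin by auto
      with J assms show ?thesis by auto
    qed (auto simp: subset_iff)
  qed
  have fin_family: "finite (?A r t)" for r t
    by (rule finite_subset[of _ "Pow {s..t}"]) auto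
  have inj: "inj_on (insert (Suc t)) (?A r t)"
    by (rule inj_onI) (metis (mono_tags, lifting) Suc_n_not_le_n atLeastAtMost_iff insert_ident mem_Collect_eq subsetD)
  have "S (Suc r) s (Suc t) = S (Suc r) s t + (\<Sum>I\<in>insert (Suc t) ` ?A r t. \<Prod>i\<in>I. 1 / real i)"
    unfolding S_def family_split
    by (rule sum.union_disjoint[OF fin_family finite_imageI[OF fin_family]]) (auto simp: subset_iff)
  also have "(\<Sum>I\<in>insert (Suc t) ` ?A r t. \<Prod>i\<in>I. 1 / real i)
      = (\<Sum>I\<in>?A r t. (\<Prod>i\<in>I. 1 / real i) / real (Suc t))"
    unfolding sum.reindex[OF inj] o_def
  proof (rule sum.cong[OF refl])
    fix I assume "I \<in> ?A r t"
    then have "Suc t \<notin> I" "finite I" using fin by auto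
    then show "(\<Prod>i\<in>insert (Suc t) I. 1 / real i) = (\<Prod>i\<in>I. 1 / real i) / real (Suc t)"
      by simp
  qed
  finally show ?thesis by (simp add: S_def sum_divide_distrib)
qed

text \<open>The coefficients of the \<open>j\<close>-th derivative of \<open>ln x ^ p / x ^ q\<close>. The logarithm loses \<open>r\<close> of its
  powers when \<open>r\<close> of the \<open>j\<close> differentiations hit it and not the power of \<open>x\<close>; this gives
  \<open>p! / (p - r)!\<close>, and in the rising factorial \<open>q * \<dots> * (q + j - 1)\<close> the factors of those \<open>r\<close>
  differentiations are missing, whence the sum \<open>S r\<close> of reciprocals over all choices.\<close>

definition log_coeff :: "nat \<Rightarrow> nat \<Rightarrow> nat \<Rightarrow> nat \<Rightarrow> real" where
  "log_coeff p q j r = (-1) ^ j * (fact (q + j - 1) / fact (q - 1))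
     * ((-1) ^ r * fact p / fact (p - r)) * S r q (q + j - 1)"

lemma log_poly_log_coeff_has_derivative:
  assumes "1 \<le> q" "0 < x"
  shows "(log_poly (log_coeff p q j) p (q + j) has_real_derivative
    log_poly (log_coeff p q (Suc j)) p (q + Suc j) x) (at x)"
proof -
  obtain t where t: "q + j = Suc t" "q + j - 1 = t" "q + Suc j - 1 = Suc t" "q \<le> Suc t"
    using assms by (cases "q + j") auto
  have "(log_poly (log_coeff p q j) p (q + j) has_real_derivative
      log_poly (log_coeff p q (Suc j)) p (Suc (q + j)) x) (at x)"
  proof (rule log_poly_has_derivative[OF \<open>0 < x\<close>])
    show "log_coeff p q (Suc j) 0 = - real (q + j) * log_coeff p q j 0"
      unfolding log_coeff_def t by (simp add: S_0 field_simps)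
    fix r assume "r < p"
    then obtain w where w: "p - r = Suc w" "p - Suc r = w"
      by (metis Suc_diff_Suc)
    show "log_coeff p q (Suc j) (Suc r)
        = real (p - r) * log_coeff p q j r - real (q + j) * log_coeff p q j (Suc r)"
      unfolding log_coeff_def t w S_Suc_Suc[OF t(4)]
      by (simp add: field_simps del: of_nat_Suc)
  qed
  then show ?thesis by simp
qed

lemma log_coeff_0: "1 \<le> q \<Longrightarrow> log_coeff p q 0 r = (if r = 0 then 1 else 0)"
  by (cases r) (simp_all add: log_coeff_def S_0 S_Suc_empty)

lemma log_poly_log_coeff_0: "1 \<le> q \<Longrightarrow> log_poly (log_coeff p q 0) p q x = ln x ^ p / x ^ q"
  by (simp add: log_poly_def log_coeff_0 if_distrib[of "\<lambda>c. c * _"] cong: if_cong)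

lemma log_poly_at_1: "log_poly c p s 1 = c p"
proof -
  have "(\<Sum>r=0..p. c r * 0 ^ (p - r)) = (\<Sum>r\<in>{p}. c r * 0 ^ (p - r))"
    by (rule sum.mono_neutral_right) auto
  then show ?thesis by (simp add: log_poly_def)
qed

text \<open>With \<open>j = 2 * k - 1\<close> odd, the sign \<open>(-1) ^ j\<close> accounts for the minus sign in front of the sum of the
  \<open>d p q k r\<close> in the expansion.\<close>

lemma bernoulli_log_coeff:
  assumes "1 \<le> k"
  shows "bernoulli (2 * k) / fact (2 * k) * log_coeff p q (2 * k - 1) r = - d p q k r"
proof -
  have "q + (2 * k - 1) - 1 = 2 * k + q - 2" "(-1) ^ (2 * k - 1) = (-1 :: real)"
    using assms by (auto simp: odd_pos)
  then show ?thesis by (simp add: log_coeff_def d_def)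
qed

section \<open>Derivatives of the zeta function\<close>

text \<open>The logarithms cost less than any power, so the exponent halfway between \<open>s\<close> and \<open>-1\<close> still
  dominates.\<close>

lemma summable_log_power_powr:
  assumes "s < -1"
  shows "summable (\<lambda>n. ln (real (Suc n)) ^ p * real (Suc n) powr s)"
proof -
  define t where "t = (s - 1) / 2"
  have "t < -1" "s < t" using assms by (simp_all add: t_def)
  then have "(\<lambda>n. ln (real n) ^ p * real n powr s) \<in> O(\<lambda>n. real n powr t)"
    by real_asymp
  moreover have "summable (\<lambda>n. norm (real n powr t))"
    using \<open>t < -1\<close> by (simp add: summable_real_powr_iff)
  ultimately have "summable (\<lambda>n. ln (real n) ^ p * real n powr s)"
    by (rule summable_comparison_test_bigo[rotated])
  then show ?thesis by (subst summable_Suc_iff)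
qed

definition zeta_deriv_term :: "nat \<Rightarrow> nat \<Rightarrow> complex \<Rightarrow> complex" where
  "zeta_deriv_term p n s = complex_of_real ((- ln (real (Suc n))) ^ p) * of_nat (Suc n) powr (- s)"

lemma zeta_deriv_term_has_derivative:
  "(zeta_deriv_term p n has_field_derivative zeta_deriv_term (Suc p) n s) (at s)"
proof -
  have "((\<lambda>s. of_nat (Suc n) powr (- s)) has_field_derivative
      - complex_of_real (ln (real (Suc n))) * of_nat (Suc n) powr (- s)) (at s)"
  proof -
    have "((\<lambda>s. of_nat (Suc n) powr (- s)) has_field_derivative
        Ln (of_nat (Suc n)) * of_nat (Suc n) powr (- s) * - 1) (at s)"
      by (rule DERIV_chain2[OF has_field_derivative_powr_right]) (auto intro: derivative_intros simp del: of_nat_Suc)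
    then show ?thesis by (simp add: Ln_of_nat del: of_nat_Suc)
  qed
  from DERIV_cmult[OF this, of "complex_of_real ((- ln (real (Suc n))) ^ p)"]
  show ?thesis by (simp add: zeta_deriv_term_def[abs_def] mult_ac del: of_nat_Suc)
qed

lemma norm_zeta_deriv_term:
  "norm (zeta_deriv_term p n s) = ln (real (Suc n)) ^ p * real (Suc n) powr (- Re s)"
proof -
  have "norm (of_nat (Suc n) powr (- s)) = real (Suc n) powr (- Re s)"
    by (subst norm_powr_real_powr) (auto simp del: of_nat_Suc)
  then show ?thesis
    by (simp add: zeta_deriv_term_def norm_mult norm_power del: of_nat_Suc)
qed

text \<open>Termwise differentiation needs a summable majorant near each point. On the disc around \<open>s\<close> with
  radius \<open>\<delta>\<close>, half the distance to the line \<open>Re s = 1\<close>, the real part stays above \<open>1 + \<delta>\<close>, and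
  the modulus of a term depends on the real part alone.\<close>

lemma zeta_deriv_series:
  assumes "1 < Re s"
  shows "summable (\<lambda>n. zeta_deriv_term p n s)"
    and "((\<lambda>s. \<Sum>n. zeta_deriv_term p n s) has_field_derivative (\<Sum>n. zeta_deriv_term (Suc p) n s)) (at s)"
proof -
  let ?A = "{s. 1 < Re s}"
  have A: "open ?A" by (rule open_halfspace_Re_gt)
  have "\<exists>\<delta> h. 0 < \<delta> \<and> summable h \<and> range h \<subseteq> \<real>\<^sub>\<ge>\<^sub>0 \<and>
      (\<forall>\<^sub>F n in sequentially. \<forall>y\<in>ball s \<delta> \<inter> ?A. cmod (zeta_deriv_term p n y) \<le> cmod (h n))"
    if "s \<in> ?A" for s
  proof -
    define \<delta> where "\<delta> = (Re s - 1) / 2"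
    define h where "h n = ln (real (Suc n)) ^ p * real (Suc n) powr (- 1 - \<delta>)" for n
    have \<delta>: "\<delta> > 0" "Re s - \<delta> = 1 + \<delta>" using that by (auto simp: \<delta>_def field_simps)
    have h: "summable h" unfolding h_def using \<delta> by (intro summable_log_power_powr) simp
    have h_nonneg: "0 \<le> h n" for n by (simp add: h_def del: of_nat_Suc)
    have "cmod (zeta_deriv_term p n y) \<le> h n" if "y \<in> ball s \<delta>" for n y
    proof -
      have "\<bar>Re (s - y)\<bar> < \<delta>"
        using that abs_Re_le_cmod[of "s - y"] by (simp add: dist_norm)
      then have "- Re y \<le> - 1 - \<delta>" using \<delta> by (simp add: abs_less_iff)
      then show ?thesis
        unfolding norm_zeta_deriv_term h_def
        by (intro mult_left_mono powr_mono) (auto simp del: of_nat_Suc)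
    qed
    then show ?thesis
      using \<delta> h h_nonneg
      by (intro exI[of _ \<delta>] exI[of _ "\<lambda>n. complex_of_real (h n)"])
         (auto simp: summable_of_real_iff)
  qed
  then have "\<exists>g g'. \<forall>s\<in>?A. (\<lambda>n. zeta_deriv_term p n s) sums g s \<and>
      (\<lambda>n. zeta_deriv_term (Suc p) n s) sums g' s \<and> (g has_field_derivative g' s) (at s)"
    by (rule series_and_derivative_comparison_complex[OF A zeta_deriv_term_has_derivative])
  then obtain g g' where g: "\<forall>s\<in>?A. (\<lambda>n. zeta_deriv_term p n s) sums g s \<and>
      (\<lambda>n. zeta_deriv_term (Suc p) n s) sums g' s \<and> (g has_field_derivative g' s) (at s)"
    by blast
  have s: "s \<in> ?A" using assms by simp
  then show "summable (\<lambda>n. zeta_deriv_term p n s)"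
    using g sums_summable by blast
  have "(g has_field_derivative (\<Sum>n. zeta_deriv_term (Suc p) n s)) (at s)"
    using g s by (metis sums_unique)
  then show "((\<lambda>s. \<Sum>n. zeta_deriv_term p n s) has_field_derivative (\<Sum>n. zeta_deriv_term (Suc p) n s)) (at s)"
    by (rule has_field_derivative_transform_within_open[OF _ A s]) (use g sums_unique in blast)
qed

lemma higher_deriv_zeta:
  assumes "1 < Re s"
  shows "(deriv ^^ p) zeta s = (\<Sum>n. zeta_deriv_term p n s)"
proof -
  have "zeta = (\<lambda>s. \<Sum>n. zeta_deriv_term 0 n s)"
    by (simp add: zeta_def[abs_def] zeta_deriv_term_def powr_minus_divide)
  then show ?thesis
    using higher_deriv_eq[of "{s. 1 < Re s}" "\<lambda>p s. \<Sum>n. zeta_deriv_term p n s" s p]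
      open_halfspace_Re_gt zeta_deriv_series(2) assms
    by simp
qed

lemma log_power_sums_zeta_deriv:
  assumes "2 \<le> q"
  shows "\<exists>Z. complex_of_real Z = (-1) ^ p * (deriv ^^ p) zeta (of_nat q) \<and>
    (\<lambda>n. \<Sum>k=1..n. ln (real k) ^ p / real k ^ q) \<longlonglongrightarrow> Z"
proof -
  let ?f = "\<lambda>k. ln (real k) ^ p / real k ^ q"
  have q: "1 < Re (of_nat q)" using assms by simp
  have "zeta_deriv_term p n (of_nat q) = (-1) ^ p * complex_of_real (?f (Suc n))" for n
  proof -
    have "complex_of_nat (Suc n) powr (- of_nat q) = 1 / of_nat (Suc n) ^ q"
      by (simp add: powr_minus_divide powr_nat' del: of_nat_Suc)
    then show ?thesis
      by (simp add: zeta_deriv_term_def power_minus[of "complex_of_real _"] del: of_nat_Suc)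
  qed
  with zeta_deriv_series(1)[OF q, of p] higher_deriv_zeta[OF q, of p]
  have "(\<lambda>n. (-1) ^ p * complex_of_real (?f (Suc n))) sums (deriv ^^ p) zeta (of_nat q)"
    by (simp add: summable_sums del: of_nat_Suc)
  from sums_mult[OF this, of "(-1) ^ p"]
  have complex_sums: "(\<lambda>n. complex_of_real (?f (Suc n))) sums ((-1) ^ p * (deriv ^^ p) zeta (of_nat q))"
    by (simp add: mult.assoc[symmetric] power_mult_distrib[symmetric] del: of_nat_Suc)
  then have "summable (\<lambda>n. ?f (Suc n))"
    by (metis sums_summable summable_of_real_iff)
  then obtain Z where Z: "(\<lambda>n. ?f (Suc n)) sums Z" by (auto simp: summable_def)
  then have "(\<lambda>n. \<Sum>k=1..n. ?f k) \<longlonglongrightarrow> Z"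
    by (simp add: sums_def sum.atLeast1_atMost_eq del: of_nat_Suc)
  moreover have "complex_of_real Z = (-1) ^ p * (deriv ^^ p) zeta (of_nat q)"
    using complex_sums Z sums_unique2 sums_of_real by blast
  ultimately show ?thesis by blast
qed

section \<open>The asymptotic expansion\<close>

theorem lemma4p4:
  fixes p q m :: nat
  assumes "q \<ge> 2" and "m \<ge> 1"
  shows "\<exists>Z::real.
    complex_of_real Z = (-1) ^ p * (deriv ^^ p) zeta (of_nat q) \<and>
    (\<lambda>n::nat. (\<Sum>k=1..n. ln (real k) ^ p / real k ^ q)
       - (Z
          - 1 / real n ^ (q - 1)
              * (\<Sum>r=0..p. fact p / (fact (p - r) * (real q - 1) ^ (r + 1)) * ln (real n) ^ (p - r))
          + 1 / 2 * (ln (real n) ^ p / real n ^ q)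
          - (\<Sum>k=1..m. (\<Sum>r=0..p. d p q k r * ln (real n) ^ (p - r)) / real n ^ (q + 2 * k - 1))))
      \<in> O[at_top](\<lambda>n. ln (real n) ^ p / real n ^ (q + 2 * m)) \<and>
    EM_formal_constant (\<lambda>x. ln x ^ p / x ^ q) Z
      (\<lambda>k. if k = 0 then fact p / (real q - 1) ^ (p + 1) + (if p = 0 then 1 / 2 else 0)
           else (-1) ^ p * fact p * (bernoulli (2 * k) / fact (2 * k)
                  * (fact (2 * k + q - 2) / fact (q - 1)) * S p q (2 * k + q - 2)))"
proof -
  define f where "f x = ln x ^ p / x ^ q" for x :: real
  define F where "F j = log_poly (log_coeff p q j) p (q + j)" for j
  have F0: "F 0 = f" using assms by (simp add: F_def f_def fun_eq_iff log_poly_log_coeff_0)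
  have F: "(F j has_real_derivative F (Suc j) x) (at x)" if "0 < x" for j x
    unfolding F_def using assms that by (intro log_poly_log_coeff_has_derivative) auto
  have F_abs: "F j absolutely_integrable_on {a..}" if "1 \<le> a" for j a
    unfolding F_def using assms that by (intro log_poly_absolutely_integrable) auto
  have F_abs1: "F j absolutely_integrable_on {1..}" for j by (rule F_abs) simp
  obtain Z where Z: "complex_of_real Z = (-1) ^ p * (deriv ^^ p) zeta (of_nat q)"
    "(\<lambda>n. \<Sum>k=1..n. f (real k)) \<longlonglongrightarrow> Z"
    using log_power_sums_zeta_deriv[OF \<open>q \<ge> 2\<close>, of p] unfolding f_def by blast
  have int_f: "integral {a..} f = log_tail p q a" if "1 \<le> a" for a
    unfolding f_def using has_integral_log_tail[OF \<open>q \<ge> 2\<close> that] by (rule integral_unique)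

  define a where "a k = (if k = 0 then fact p / (real q - 1) ^ (p + 1) + (if p = 0 then 1 / 2 else 0)
           else (-1) ^ p * fact p * (bernoulli (2 * k) / fact (2 * k)
                  * (fact (2 * k + q - 2) / fact (q - 1)) * S p q (2 * k + q - 2)))" for k
  have EM: "EM_formal_constant (F 0) Z a"
  proof (rule EM_formal_constantI[where F = F, OF F F_abs1])
    show "(F j \<longlongrightarrow> 0) at_top" for j
      unfolding F_def using assms by (intro log_poly_tendsto_0) simp
    show "(\<lambda>n. \<Sum>k=1..n. F 0 (real k)) \<longlonglongrightarrow> Z"
      using Z F0 by simp
    show "a k = (if k = 0 then integral {1..} (F 0) + F 0 1 / 2
        else - (bernoulli (2 * k) / fact (2 * k) * F (2 * k - 1) 1))" for k
    proof (cases "k = 0")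
      case True
      then show ?thesis
        using assms by (simp add: a_def F0 int_f log_tail_def log_poly_at_1 f_def power_0_left)
    next
      case False
      then have "a k = d p q k p" by (simp add: a_def d_def)
      then show ?thesis
        using False bernoulli_log_coeff[of k p q p] by (simp add: F_def log_poly_at_1)
    qed
  qed

  \<comment> \<open>The tail of the remainder integral is bounded by the explicit tails of the logarithmic powers
    that make up the derivative of order \<open>2 * m + 1\<close>.\<close>
  obtain K where K: "K \<ge> 0" "\<And>x. 0 < x \<Longrightarrow> \<bar>EM_remainder (F 0) m x\<bar> \<le> K * \<bar>F (2 * m + 1) x\<bar>"
    using EM_remainder_bound[where F = F, OF F F_abs1, of m] by auto
  let ?s = "q + (2 * m + 1)"
  define E where "E n = integral {n..} (EM_remainder (F 0) m)" for n :: real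
  define B where "B n = K * (\<Sum>r=0..p. \<bar>log_coeff p q (2 * m + 1) r\<bar> * log_tail (p - r) ?s n)" for n :: real
  have rem_abs: "EM_remainder (F 0) m absolutely_integrable_on {1..}"
    by (rule EM_remainder_absolutely_integrable[where F = F, OF F F_abs1])
  have E_le: "\<bar>E n\<bar> \<le> B n" if "1 \<le> n" for n
  proof -
    have "\<bar>E n\<bar> \<le> integral {n..} (\<lambda>x. K * \<bar>F (2 * m + 1) x\<bar>)"
      unfolding E_def real_norm_def[symmetric]
    proof (rule integral_norm_bound_integral)
      show "EM_remainder (F 0) m integrable_on {n..}"
        using integral_tail_split(1)[OF rem_abs that] by (rule set_lebesgue_integral_eq_integral(1))
      show "(\<lambda>x. K * norm (F (2 * m + 1) x)) integrable_on {n..}"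
        using F_abs[OF that] by (intro integrable_on_mult_right) (simp add: absolutely_integrable_on_def)
    qed (use K that in auto)
    also have "\<dots> \<le> B n"
      unfolding B_def F_def integral_mult_right using K assms that
      by (intro mult_left_mono integral_abs_log_poly_le) auto
    finally show ?thesis .
  qed
  have E_bigo: "E \<in> O(\<lambda>x. ln x ^ p / x ^ (q + 2 * m))"
  proof (rule landau_o.big_trans)
    show "E \<in> O(B)"
      by (rule bigoI[of _ 1], rule eventually_mono[OF eventually_ge_at_top[of 1]])
         (use E_le in \<open>force intro: order_trans[OF _ abs_ge_self]\<close>)
    have "log_tail (p - r) ?s \<in> O(\<lambda>x. ln x ^ p / x ^ (q + 2 * m))" for r
      using log_poly_bigo[of "p - r" p _ "?s - 1"] by (simp add: log_tail_def)
    then have "(\<lambda>n. \<bar>log_coeff p q (2 * m + 1) r\<bar> * log_tail (p - r) ?s n)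
        \<in> O(\<lambda>x. ln x ^ p / x ^ (q + 2 * m))" for r
      by (cases "log_coeff p q (2 * m + 1) r = 0") simp_all
    then have "(\<lambda>n. \<Sum>r=0..p. \<bar>log_coeff p q (2 * m + 1) r\<bar> * log_tail (p - r) ?s n)
        \<in> O(\<lambda>x. ln x ^ p / x ^ (q + 2 * m))"
      by (intro big_sum_in_bigo)
    then show "B \<in> O(\<lambda>x. ln x ^ p / x ^ (q + 2 * m))"
      unfolding B_def[abs_def] by (cases "K = 0") simp_all
  qed

  \<comment> \<open>The expansion is the Euler--Maclaurin formula of order \<open>m\<close> term by term, so what is left over is
    the tail \<open>E\<close> of the remainder.\<close>
  have exact: "(\<Sum>k=1..n. ln (real k) ^ p / real k ^ q)
       - (Z
          - 1 / real n ^ (q - 1)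
              * (\<Sum>r=0..p. fact p / (fact (p - r) * (real q - 1) ^ (r + 1)) * ln (real n) ^ (p - r))
          + 1 / 2 * (ln (real n) ^ p / real n ^ q)
          - (\<Sum>k=1..m. (\<Sum>r=0..p. d p q k r * ln (real n) ^ (p - r)) / real n ^ (q + 2 * k - 1)))
      = - E (real n)" if "1 \<le> n" for n :: nat
  proof -
    have deriv_F: "(deriv ^^ j) (F 0) x = F j x" if "0 < x" for j x
      using higher_deriv_eq[of "{0<..}" F x j] F that by simp
    have "bernoulli (2 * k) / fact (2 * k) * F (2 * k - 1) (real n)
        = - ((\<Sum>r=0..p. d p q k r * ln (real n) ^ (p - r)) / real n ^ (q + 2 * k - 1))"
      if "1 \<le> k" for k
    proof -
      have "q + (2 * k - 1) = q + 2 * k - 1" using that by simp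
      then show ?thesis
        unfolding F_def log_poly_def times_divide_eq_right sum_distrib_left mult.assoc[symmetric]
          bernoulli_log_coeff[OF that]
        by (simp add: sum_negf)
    qed
    then have "(\<Sum>k=1..m. bernoulli (2 * k) / fact (2 * k) * (deriv ^^ (2 * k - 1)) (F 0) (real n))
        = - (\<Sum>k=1..m. (\<Sum>r=0..p. d p q k r * ln (real n) ^ (p - r)) / real n ^ (q + 2 * k - 1))"
      using that by (simp add: deriv_F sum_negf[symmetric])
    moreover have "integral {real n..} f = 1 / real n ^ (q - 1)
              * (\<Sum>r=0..p. fact p / (fact (p - r) * (real q - 1) ^ (r + 1)) * ln (real n) ^ (p - r))"
      using that by (simp add: int_f log_tail_def log_poly_def)
    moreover have "(\<Sum>k=1..n. F 0 (real k)) = Z - integral {real n..} (F 0) + F 0 (real n) / 2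
        + (\<Sum>k=1..m. bernoulli (2 * k) / fact (2 * k) * (deriv ^^ (2 * k - 1)) (F 0) (real n))
        - integral {real n..} (EM_remainder (F 0) m)"
      using EM that unfolding EM_formal_constant_def by blast
    ultimately show ?thesis
      by (simp add: F0 E_def f_def)
  qed
  have "(\<lambda>n. - E (real n)) \<in> O(\<lambda>n. ln (real n) ^ p / real n ^ (q + 2 * m))"
    using landau_o.big.compose[OF E_bigo filterlim_real_sequentially] by simp
  then have "(\<lambda>n::nat. (\<Sum>k=1..n. ln (real k) ^ p / real k ^ q)
       - (Z
          - 1 / real n ^ (q - 1)
              * (\<Sum>r=0..p. fact p / (fact (p - r) * (real q - 1) ^ (r + 1)) * ln (real n) ^ (p - r))
          + 1 / 2 * (ln (real n) ^ p / real n ^ q)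
          - (\<Sum>k=1..m. (\<Sum>r=0..p. d p q k r * ln (real n) ^ (p - r)) / real n ^ (q + 2 * k - 1))))
      \<in> O[at_top](\<lambda>n. ln (real n) ^ p / real n ^ (q + 2 * m))"
    by (rule landau_o.big.in_cong[THEN iffD2, rotated])
       (rule eventually_mono[OF eventually_ge_at_top[of 1]], rule exact)
  with Z(1) EM show ?thesis
    unfolding F0 f_def[abs_def] a_def[abs_def] by blast
qed

end
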